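(* For every $n\ge1$, the poset $(\mathcal E_n,\le_C)$ is isomorphic to the poset $(\mathcal P_n,\preceq)$.
   Context: An $(n,n)$-clan is a string $\gamma=c_1\cdots c_{2n}$ of symbols from $\mathbb{N}\cup\{+,-\}$ such that each natural number appearing appears exactly twice and the numbers of $+$'s and $-$'s are equal; clans are equal if they have the same $\pm$ symbols in the same positions and the same sets of positions of matching pairs. $\gamma$ is skew-symmetric if $\gamma=-rev(\gamma)$, where $rev$ reverses the string and $-$ interchanges $+$ and $-$. The base clan of $\gamma$ is obtained by replacing, for each matching pair $c_i=c_j\in\mathbb N$ with $i<j$, the symbol $c_i$ by $-$ and $c_j$ by $+$. $\mathcal E_n$ is the set of skew-symmetric $(n,n)$-clans with base clan $\underbrace{-\cdots-}_{n}\underbrace{+\cdots+}_{n}$. For a clan $\gamma=c_1\cdots c_{2n}$ and $1\le i<j\le 2n$: $\gamma(i;+)$ is the number of $+$ signs plus the number of pairs of equal natural numbers both occurring among $c_1\cdots c_i$; $\gamma(i;-)$ is the number of $-$ signs plus the number of pairs of equal natural numbers both occurring among $c_1\cdots c_i$; $\gamma(i;j)$ is the number of pairs $c_s=c_t\in\mathbb N$ with $s\le i<j<t$. The conjectural $CI$ Bruhat order $\le_C$ on skew-symmetric $(n,n)$-clans is the restriction of the closure order on all $(n,n)$-clans (closure order of $GL_n\times GL_n$-orbits in the flag variety of $GL_{2n}$), which by a theorem of Wyser is: $\gamma\le_C\tau$ iff for all $i$ and all $i<j$: $\gamma(i;+)\ge\tau(i;+)$, $\gamma(i;-)\ge\tau(i;-)$,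 and $\gamma(i;j)\le\tau(i;j)$. $\mathcal P_n$ is the set of partial involutions on $n$ letters, i.e. symmetric $n\times n$ $0/1$ matrices with at most one $1$ in each row and column. For such a matrix $\pi$ and $1\le k,l\le n$, let $\pi_{k,l}$ be its upper-left $k\times l$ submatrix; $\pi\preceq\sigma$ iff $\mathrm{rank}(\pi_{k,l})\le\mathrm{rank}(\sigma_{k,l})$ for all $k,l$. *)

theory Defs
  imports "Jordan_Normal_Form.DL_Rank"
begin

datatype clan_symbol = Plus | Minus | Label nat

text \<open>List positions count from 0, so the symbol \<open>c\<^sub>i\<close> of the mathematical notation is
  \<open>w ! (i - 1)\<close>, and \<open>take i w\<close> is \<open>c\<^sub>1 \<dots> c\<^sub>i\<close>.\<close>

definition positions :: "clan_symbol \<Rightarrow> clan_symbol list \<Rightarrow> nat set" where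
  "positions c w = {s. s < length w \<and> w ! s = c}"

definition arcs :: "clan_symbol list \<Rightarrow> (nat \<times> nat) set" where
  "arcs w = {(s, t). s < t \<and> t < length w \<and> (\<exists>a. w ! s = Label a \<and> w ! t = Label a)}"

text \<open>Strings representing an \<open>(n,n)\<close>-clan for some \<open>n\<close>; then \<open>2 * n\<close> is the length.\<close>

definition clan_word :: "clan_symbol list \<Rightarrow> bool" where
  "clan_word w \<longleftrightarrow>
     (\<forall>a. Label a \<in> set w \<longrightarrow> count_list w (Label a) = 2) \<and>
     count_list w Plus = count_list w Minus"

definition same_clan :: "clan_symbol list \<Rightarrow> clan_symbol list \<Rightarrow> bool" where
  "same_clan v w \<longleftrightarrow> clan_word v \<and> clan_word w \<and> length v = length w \<and>
     positions Plus v = positions Plus w \<and> positions Minus v = positions Minus w \<and>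
     arcs v = arcs w"

quotient_type clan = "clan_symbol list" / partial: same_clan
proof (rule part_equivpI)
  have "same_clan [] []" by (simp add: same_clan_def clan_word_def)
  then show "\<exists>w. same_clan w w" by blast
  show "symp same_clan" by (rule sympI) (auto simp: same_clan_def)
  show "transp same_clan" by (rule transpI) (auto simp: same_clan_def)
qed

fun negate_symbol :: "clan_symbol \<Rightarrow> clan_symbol" where
  "negate_symbol Plus = Minus"
| "negate_symbol Minus = Plus"
| "negate_symbol (Label a) = Label a"

definition base_word :: "clan_symbol list \<Rightarrow> clan_symbol list" where
  "base_word w = map (\<lambda>i. case w ! i of
       Plus \<Rightarrow> Plus
     | Minus \<Rightarrow> Minus
     | Label a \<Rightarrow> if \<exists>j. (i, j) \<in> arcs w then Minus else Plus) [0..<length w]"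

lemma count_list_eq_card_positions: "count_list w c = card (positions c w)"
  by (simp add: count_list_eq_length_filter length_filter_conv_card positions_def eq_commute)

lemma positions_take: "positions c (take i w) = {s \<in> positions c w. s < i}"
  by (auto simp: positions_def)

lemma arcs_take: "arcs (take i w) = {(s, t) \<in> arcs w. t < i}"
  by (auto simp: arcs_def)

lemma positions_rev: "positions c (rev w) = (\<lambda>s. length w - Suc s) ` positions c w"
  (is "?L = ?R")
proof
  show "?L \<subseteq> ?R"
  proof
    fix s assume "s \<in> ?L"
    then have "s = length w - Suc (length w - Suc s)" "length w - Suc s \<in> positions c w"
      by (auto simp: positions_def rev_nth)
    then show "s \<in> ?R" by blast
  qed
qed (auto simp: positions_def rev_nth)

lemma arcs_rev:
  "arcs (rev w) = (\<lambda>(s, t). (length w - Suc t, length w - Suc s)) ` arcs w" (is "?L = ?R")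
proof
  show "?L \<subseteq> ?R"
  proof (rule subrelI)
    fix s t assume "(s, t) \<in> ?L"
    then have "(length w - Suc t, length w - Suc s) \<in> arcs w"
      "s = length w - Suc (length w - Suc s)" "t = length w - Suc (length w - Suc t)"
      by (auto simp: arcs_def rev_nth)
    then show "(s, t) \<in> ?R"
      by (metis (mono_tags, lifting) case_prod_conv image_eqI)
  qed
qed (auto simp: arcs_def rev_nth)

lemma negate_symbol_simps:
  "negate_symbol x = Plus \<longleftrightarrow> x = Minus"
  "negate_symbol x = Minus \<longleftrightarrow> x = Plus"
  "negate_symbol x = Label a \<longleftrightarrow> x = Label a"
  by (cases x; simp)+

lemma positions_negate:
  "positions Plus (map negate_symbol w) = positions Minus w"
  "positions Minus (map negate_symbol w) = positions Plus w"
  "positions (Label a) (map negate_symbol w) = positions (Label a) w"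
  by (auto simp: positions_def negate_symbol_simps)

lemma arcs_negate: "arcs (map negate_symbol w) = arcs w"
  by (auto simp: arcs_def negate_symbol_simps)

lemma clan_word_negate: "clan_word w \<Longrightarrow> clan_word (map negate_symbol w)"
  by (auto simp: clan_word_def count_list_eq_card_positions positions_negate)
    (metis negate_symbol_simps(3))

lemma clan_word_rev: "clan_word w \<Longrightarrow> clan_word (rev w)"
  by (simp add: clan_word_def)

lemma card_positions_label:
  assumes "clan_word w" "s < length w" "w ! s = Label a"
  shows "card (positions (Label a) w) = 2"
proof -
  have "Label a \<in> set w" using assms(2,3) by (metis nth_mem)
  then have "count_list w (Label a) = 2" using assms(1) by (simp add: clan_word_def)
  then show ?thesis by (simp only: count_list_eq_card_positions)
qed

lemma arc_positions:
  assumes "clan_word w" "s < t" "t < length w" "w ! s = Label a" "w ! t = Label a"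
  shows "positions (Label a) w = {s, t}"
proof (rule card_seteq[symmetric])
  show "finite (positions (Label a) w)" by (simp add: positions_def)
  show "{s, t} \<subseteq> positions (Label a) w" using assms by (simp add: positions_def)
  show "card (positions (Label a) w) \<le> card {s, t}"
    using card_positions_label[OF assms(1,3,5)] assms(2) by simp
qed

lemma arc_unique:
  assumes w: "clan_word w" and st: "(s, t) \<in> arcs w" and st': "(s', t') \<in> arcs w"
    and "s = s' \<or> t = t' \<or> t = s'"
  shows "s = s' \<and> t = t'"
proof -
  obtain a where a: "s < t" "t < length w" "w ! s = Label a" "w ! t = Label a"
    using st by (auto simp: arcs_def)
  obtain b where b: "s' < t'" "t' < length w" "w ! s' = Label b" "w ! t' = Label b"
    using st' by (auto simp: arcs_def)
  have "a = b" using assms(4) a(3,4) b(3,4) by (elim disjE) simp_all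
  then have "{s, t} = {s', t'}"
    using arc_positions[OF w a] arc_positions[OF w b] by simp
  then show ?thesis
    using a(1) b(1) by (auto simp: doubleton_eq_iff)
qed

lemma label_in_arc:
  assumes "clan_word w" "s < length w" "w ! s = Label a"
  shows "\<exists>t. (s, t) \<in> arcs w \<or> (t, s) \<in> arcs w"
proof -
  obtain x y where "positions (Label a) w = {x, y}" "x \<noteq> y"
    using card_positions_label[OF assms] by (meson card_2_iff)
  then obtain t where t: "t \<in> positions (Label a) w" "t \<noteq> s"
    by (metis insertI1 insertI2)
  then have "t < length w" "w ! t = Label a" by (simp_all add: positions_def)
  with t(2) assms have "(s, t) \<in> arcs w \<or> (t, s) \<in> arcs w"
    by (cases "s < t") (simp_all add: arcs_def)
  then show ?thesis ..
qed

lemma finite_arcs: "finite (arcs w)"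
  by (rule finite_subset[of _ "{..<length w} \<times> {..<length w}"]) (auto simp: arcs_def)

lemma positions_base_word:
  assumes "clan_word w"
  shows "positions Minus (base_word w) = positions Minus w \<union> fst ` arcs w"
    and "positions Plus (base_word w) = positions Plus w \<union> snd ` arcs w"
    and "positions (Label a) (base_word w) = {}"
proof -
  show "positions Minus (base_word w) = positions Minus w \<union> fst ` arcs w"
    by (force simp: positions_def base_word_def arcs_def split: clan_symbol.splits if_splits)
  show "positions Plus (base_word w) = positions Plus w \<union> snd ` arcs w" (is "?L = ?R")
  proof
    show "?L \<subseteq> ?R"
    proof
      fix s assume s: "s \<in> ?L"
      then have sl: "s < length w" by (simp add: positions_def base_word_def)
      show "s \<in> ?R"
      proof (cases "w ! s")
        case Plus
        then show ?thesis using sl by (simp add: positions_def)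
      next
        case Minus
        then show ?thesis using s sl by (simp add: positions_def base_word_def)
      next
        case (Label a)
        then have "\<nexists>j. (s, j) \<in> arcs w"
          using s by (auto simp: positions_def base_word_def split: if_splits)
        then obtain t where "(t, s) \<in> arcs w"
          using label_in_arc[OF assms sl Label] by blast
        then show ?thesis by force
      qed
    qed
    show "?R \<subseteq> ?L"
    proof
      fix s assume "s \<in> ?R"
      then consider "s \<in> positions Plus w" | r where "(r, s) \<in> arcs w" by auto
      then show "s \<in> ?L"
      proof cases
        case 1
        then show ?thesis by (simp add: positions_def base_word_def)
      next
        case 2
        have "(s, j) \<notin> arcs w" for j
        proof
          assume j: "(s, j) \<in> arcs w"
          then have "r = s" using arc_unique[OF assms 2 j] by simp
          then show False using 2 by (simp add: arcs_def)
        qed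
        then show ?thesis using 2 by (auto simp: positions_def base_word_def arcs_def)
      qed
    qed
  qed
  show "positions (Label a) (base_word w) = {}"
    by (auto simp: positions_def base_word_def split: clan_symbol.splits if_splits)
qed

lemma clan_word_base_word:
  assumes "clan_word w"
  shows "clan_word (base_word w)"
proof -
  have fin: "finite (positions c w)" for c by (simp add: positions_def)
  have fst: "card (fst ` arcs w) = card (arcs w)"
    by (rule card_image, rule inj_onI) (metis arc_unique[OF assms] prod.collapse)
  have snd: "card (snd ` arcs w) = card (arcs w)"
    by (rule card_image, rule inj_onI) (metis arc_unique[OF assms] prod.collapse)
  have "positions Minus w \<inter> fst ` arcs w = {}" "positions Plus w \<inter> snd ` arcs w = {}"
    by (auto simp: positions_def arcs_def)
  then have "card (positions Minus (base_word w)) = card (positions Minus w) + card (arcs w)"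
    and "card (positions Plus (base_word w)) = card (positions Plus w) + card (arcs w)"
    unfolding positions_base_word[OF assms] using fin finite_arcs[of w] fst snd
    by (simp_all add: card_Un_disjoint)
  moreover have "card (positions Plus w) = card (positions Minus w)"
    using assms by (simp add: clan_word_def count_list_eq_card_positions)
  moreover have "Label a \<notin> set (base_word w)" for a
    using positions_base_word(3)[OF assms, of a] by (auto simp: positions_def in_set_conv_nth)
  ultimately show ?thesis
    by (simp add: clan_word_def count_list_eq_card_positions)
qed

lemma arcs_base_word:
  assumes "clan_word w"
  shows "arcs (base_word w) = {}"
proof -
  have "(s, t) \<notin> arcs (base_word w)" for s t
    using positions_base_word(3)[OF assms] by (simp add: arcs_def positions_def)
  then show ?thesis by auto
qed

lift_definition clan_length :: "clan \<Rightarrow> nat" is length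
  by (simp add: same_clan_def)

lift_definition clan_rev :: "clan \<Rightarrow> clan" is rev
  by (simp add: same_clan_def clan_word_rev positions_rev arcs_rev)

lift_definition clan_neg :: "clan \<Rightarrow> clan" is "map negate_symbol"
  by (simp add: same_clan_def clan_word_negate positions_negate arcs_negate)

lift_definition base_clan :: "clan \<Rightarrow> clan" is base_word
  by (auto simp: same_clan_def clan_word_base_word positions_base_word arcs_base_word)
    (simp add: base_word_def)

lift_definition minus_plus_clan :: "nat \<Rightarrow> clan" is
  "\<lambda>n. replicate n Minus @ replicate n Plus"
  by (auto simp: same_clan_def clan_word_def count_list_eq_length_filter)

definition skew_symmetric :: "clan \<Rightarrow> bool" where
  "skew_symmetric \<gamma> \<longleftrightarrow> \<gamma> = clan_neg (clan_rev \<gamma>)"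

definition skew_clans :: "nat \<Rightarrow> clan set" where
  "skew_clans n = {\<gamma>. clan_length \<gamma> = 2 * n \<and> skew_symmetric \<gamma>}"

definition E_clans :: "nat \<Rightarrow> clan set" where
  "E_clans n = {\<gamma> \<in> skew_clans n. base_clan \<gamma> = minus_plus_clan n}"

text \<open>The numbers \<open>\<gamma>(i;+)\<close>, \<open>\<gamma>(i;-)\<close> and \<open>\<gamma>(i;j)\<close>, with \<open>i\<close> and \<open>j\<close> counted from 1: in the last
  one, the arc \<open>(s, t)\<close> joins \<open>c\<^sub>s\<^sub>+\<^sub>1\<close> and \<open>c\<^sub>t\<^sub>+\<^sub>1\<close>, so \<open>s + 1 \<le> i\<close> and \<open>j < t + 1\<close> are required.\<close>

lift_definition clan_plus :: "clan \<Rightarrow> nat \<Rightarrow> nat" is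
  "\<lambda>w i. count_list (take i w) Plus + card (arcs (take i w))"
  by (simp add: fun_eq_iff same_clan_def count_list_eq_card_positions positions_take arcs_take)

lift_definition clan_minus :: "clan \<Rightarrow> nat \<Rightarrow> nat" is
  "\<lambda>w i. count_list (take i w) Minus + card (arcs (take i w))"
  by (simp add: fun_eq_iff same_clan_def count_list_eq_card_positions positions_take arcs_take)

lift_definition clan_cross :: "clan \<Rightarrow> nat \<Rightarrow> nat \<Rightarrow> nat" is
  "\<lambda>w i j. card {(s, t) \<in> arcs w. s + 1 \<le> i \<and> j < t + 1}"
  by (simp add: fun_eq_iff same_clan_def)

text \<open>Wyser's description of the closure order on \<open>(n,n)\<close>-clans.\<close>

definition clan_le :: "nat \<Rightarrow> clan \<Rightarrow> clan \<Rightarrow> bool" where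
  "clan_le n \<gamma> \<tau> \<longleftrightarrow>
     (\<forall>i\<in>{1..2 * n}. clan_plus \<gamma> i \<ge> clan_plus \<tau> i \<and> clan_minus \<gamma> i \<ge> clan_minus \<tau> i) \<and>
     (\<forall>i\<in>{1..2 * n}. \<forall>j\<in>{i<..2 * n}. clan_cross \<gamma> i j \<le> clan_cross \<tau> i j)"

definition partial_involutions :: "nat \<Rightarrow> real mat set" where
  "partial_involutions n = {A \<in> carrier_mat n n.
     (\<forall>i<n. \<forall>j<n. A $$ (i, j) \<in> {0, 1}) \<and>
     transpose_mat A = A \<and>
     (\<forall>i<n. card {j. j < n \<and> A $$ (i, j) = 1} \<le> 1) \<and>
     (\<forall>j<n. card {i. i < n \<and> A $$ (i, j) = 1} \<le> 1)}"

definition upper_left :: "'a mat \<Rightarrow> nat \<Rightarrow> nat \<Rightarrow> 'a mat" where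
  "upper_left A k l = mat k l (\<lambda>(i, j). A $$ (i, j))"

text \<open>The first argument of \<^const>\<open>vec_space.rank\<close> is the number of rows.\<close>

definition rank_le :: "nat \<Rightarrow> real mat \<Rightarrow> real mat \<Rightarrow> bool" where
  "rank_le n A B \<longleftrightarrow>
     (\<forall>k\<in>{1..n}. \<forall>l\<in>{1..n}.
        vec_space.rank k (upper_left A k l) \<le> vec_space.rank k (upper_left B k l))"

definition poset_isomorphic ::
    "'a set \<Rightarrow> ('a \<Rightarrow> 'a \<Rightarrow> bool) \<Rightarrow> 'b set \<Rightarrow> ('b \<Rightarrow> 'b \<Rightarrow> bool) \<Rightarrow> bool" where
  "poset_isomorphic A leA B leB \<longleftrightarrow>
     partial_order_on A (relation_of leA A) \<and>
     partial_order_on B (relation_of leB B) \<and>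
     (\<exists>f. bij_betw f A B \<and> (\<forall>x\<in>A. \<forall>y\<in>A. leA x y \<longleftrightarrow> leB (f x) (f y)))"

end

theory Submission
  imports Defs
begin

text \<open>Prescribing the base clan forces every arc of \<open>\<gamma> \<in> \<E>\<^sub>n\<close> to start in the left half and to
  end in the right half, so \<open>\<gamma>\<close> is determined by its arcs; reflecting the right endpoints turns
  them into the ones of an \<open>n \<times> n\<close> matrix, which is symmetric because \<open>\<gamma>\<close> is skew-symmetric. The
  rank of an upper-left \<open>k \<times> l\<close> block is its number of ones, and this is \<open>\<gamma>(k; 2n - l)\<close>. The other
  numbers in the order on clans carry no further information: \<open>\<gamma>(i;+) = max(i - n, 0)\<close> is constant on
  \<open>\<E>\<^sub>n\<close>, \<open>\<gamma>(i;-)\<close> and \<open>\<gamma>(min(i,n); max(i,n))\<close> add up to \<open>min(i,n)\<close>, and \<open>\<gamma>(i;j)\<close> depends only on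
  \<open>min(i,n)\<close> and \<open>max(j,n)\<close>. Conversely, the block \<open>k = l = n\<close>, which the condition on \<open>\<gamma>(i;j)\<close> misses
  because it requires \<open>i < j\<close>, is covered by \<open>\<gamma>(n;-)\<close>.\<close>

section \<open>Rank of a partial permutation matrix\<close>

lemma card_le_1_unique:
  assumes "finite S" "card S \<le> 1" "x \<in> S" "y \<in> S"
  shows "x = y"
  using assms card_le_Suc0_iff_eq[of S] by auto

text \<open>By \<open>col\<close> every column is zero or a unit vector, so the nonzero columns form
  an independent set \<open>S\<close>, indexed by the rows that contain a 1. By \<open>row\<close>
  there are as many such rows as ones.\<close>

lemma (in vec_space) rank_partial_permutation:
  assumes A: "A \<in> carrier_mat n m"
    and entries: "\<And>i j. i < n \<Longrightarrow> j < m \<Longrightarrow> A $$ (i, j) \<in> {0, 1}"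
    and row: "\<And>i j j'. i < n \<Longrightarrow> j < m \<Longrightarrow> j' < m \<Longrightarrow> A $$ (i, j) = 1 \<Longrightarrow> A $$ (i, j') = 1 \<Longrightarrow> j = j'"
    and col: "\<And>i i' j. i < n \<Longrightarrow> i' < n \<Longrightarrow> j < m \<Longrightarrow> A $$ (i, j) = 1 \<Longrightarrow> A $$ (i', j) = 1 \<Longrightarrow> i = i'"
  shows "rank A = card {(i, j). i < n \<and> j < m \<and> A $$ (i, j) = 1}"
proof -
  define P where "P = {(i, j). i < n \<and> j < m \<and> A $$ (i, j) = 1}"
  define S :: "'a vec set" where "S = unit_vec n ` fst ` P"
  have colS: "col A j = unit_vec n i" if "(i, j) \<in> P" for i j
  proof (rule eq_vecI)
    fix k assume "k < dim_vec (unit_vec n i :: 'a vec)"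
    then have k: "k < n" by simp
    have ij: "i < n" "j < m" "A $$ (i, j) = 1" using that by (simp_all add: P_def)
    have "A $$ (k, j) = (if k = i then 1 else 0)"
    proof (cases "k = i")
      case False
      then have "A $$ (k, j) \<noteq> 1" using col[OF k ij(1,2)] ij(3) by blast
      then show ?thesis using entries[OF k ij(2)] False by simp
    qed (simp add: ij)
    then show "col A j $ k = unit_vec n i $ k" using A k ij by simp
  qed (use A in simp)
  have col0: "col A j = 0\<^sub>v n" if "j < m" "\<And>i. (i, j) \<notin> P" for j
  proof (rule eq_vecI)
    fix k assume "k < dim_vec (0\<^sub>v n :: 'a vec)"
    then have k: "k < n" by simp
    have "A $$ (k, j) \<noteq> 1" using that k by (simp add: P_def)
    then have "A $$ (k, j) = 0" using entries[OF k that(1)] by simp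
    then show "col A j $ k = 0\<^sub>v n $ k" using A k that(1) by simp
  qed (use A in simp)
  have SA: "S \<subseteq> set (cols A)"
  proof
    fix v assume "v \<in> S"
    then obtain i j where ij: "(i, j) \<in> P" "v = unit_vec n i" by (auto simp: S_def)
    then have "j < m" by (simp add: P_def)
    then show "v \<in> set (cols A)"
      using colS[OF ij(1)] ij(2) A by (force simp: cols_def)
  qed
  have "S \<subseteq> set (unit_vecs n)"
    by (auto simp: S_def P_def unit_vecs_def)
  moreover have "lin_indpt (set (unit_vecs n))"
    using unit_vecs_basis by (simp add: basis_def)
  ultimately have liS: "lin_indpt S" using supset_ld_is_ld by blast
  \<comment> \<open>An independent set omits the zero vector, so an independent set of columns has
    only nonzero columns, and all of these lie in \<open>S\<close>.\<close>
  have "maximal S (\<lambda>T. T \<subseteq> set (cols A) \<and> lin_indpt T)"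
    unfolding maximal_def
  proof (intro conjI allI impI)
    fix B assume B: "S \<subseteq> B \<and> B \<subseteq> set (cols A) \<and> lin_indpt B"
    then have "B \<subseteq> carrier_vec n" using A cols_dim by blast
    moreover have "(UNIV :: 'a set) \<noteq> {0}" using zero_neq_one by (metis UNIV_I singletonD)
    ultimately have "0\<^sub>v n \<notin> B" using zero_nin_lin_indpt[of B] B by auto
    have "B \<subseteq> S"
    proof
      fix v assume v: "v \<in> B"
      then obtain j where j: "j < m" "v = col A j" using B A by (auto simp: cols_def)
      then obtain i where "(i, j) \<in> P" using col0[of j] v \<open>0\<^sub>v n \<notin> B\<close> by metis
      then show "v \<in> S" using colS j by (force simp: S_def)
    qed
    then show "B = S" using B by blast
  qed (fact SA liS)+
  then have "rank A = card S" by (rule rank_card_indpt[OF A])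
  also have "\<dots> = card (fst ` P)"
    unfolding S_def by (rule card_image) (auto simp: inj_on_def P_def unit_vec_eq)
  also have "\<dots> = card P"
    by (rule card_image) (use row in \<open>auto simp: inj_on_def P_def\<close>)
  finally show ?thesis by (simp add: P_def)
qed

section \<open>Partial involutions as relations, and counting ones in corners\<close>

definition ones :: "'a::zero_neq_one mat \<Rightarrow> (nat \<times> nat) set" where
  "ones A = {(i, j). i < dim_row A \<and> j < dim_col A \<and> A $$ (i, j) = 1}"

definition corner :: "(nat \<times> nat) set \<Rightarrow> nat \<Rightarrow> nat \<Rightarrow> (nat \<times> nat) set" where
  "corner X k l = {(i, j) \<in> X. i < k \<and> j < l}"

text \<open>Reading the matrix as a relation turns the symmetry of the matrix into
  \<open>sym\<close> and the bound on rows into \<open>single_valued\<close>; the bound on columns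
  is the one on rows seen through the symmetry.\<close>

lemma partial_involutions_iff:
  "A \<in> partial_involutions n \<longleftrightarrow>
     A \<in> carrier_mat n n \<and> (\<forall>i<n. \<forall>j<n. A $$ (i, j) \<in> {0, 1}) \<and>
     sym (ones A) \<and> single_valued (ones A)"
  (is "_ \<longleftrightarrow> ?R")
proof
  assume A: "A \<in> partial_involutions n"
  then have c: "A \<in> carrier_mat n n" and t: "transpose_mat A = A"
    and r: "\<forall>i<n. card {j. j < n \<and> A $$ (i, j) = 1} \<le> 1"
    by (simp_all add: partial_involutions_def)
  have s: "A $$ (j, i) = A $$ (i, j)" if "i < n" "j < n" for i j
    using arg_cong[OF t, of "\<lambda>B. B $$ (i, j)"] that c by simp
  have "j = j'" if "(i, j) \<in> ones A" "(i, j') \<in> ones A" for i j j'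
  proof (rule card_le_1_unique)
    show "card {j. j < n \<and> A $$ (i, j) = 1} \<le> 1"
      using r that(1) c by (auto simp: ones_def)
  qed (use that c in \<open>auto simp: ones_def\<close>)
  then show ?R
    using A c s by (auto simp: partial_involutions_def ones_def sym_def single_valued_def)
next
  assume R: ?R
  then have c: "A \<in> carrier_mat n n" and bin: "\<forall>i<n. \<forall>j<n. A $$ (i, j) \<in> {0, 1}"
    and sym: "sym (ones A)" and sv: "single_valued (ones A)" by blast+
  have ones_iff: "(i, j) \<in> ones A \<longleftrightarrow> A $$ (i, j) = 1" if "i < n" "j < n" for i j
    using that c by (simp add: ones_def)
  have s: "A $$ (j, i) = A $$ (i, j)" if "i < n" "j < n" for i j
  proof -
    have "A $$ (j, i) = 1 \<longleftrightarrow> A $$ (i, j) = 1"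
      using ones_iff[OF that] ones_iff[OF that(2,1)] sym by (blast dest: symD)
    moreover have "A $$ (j, i) = 0 \<or> A $$ (j, i) = 1" "A $$ (i, j) = 0 \<or> A $$ (i, j) = 1"
      using bin that by blast+
    ultimately show ?thesis by metis
  qed
  have r: "card {j. j < n \<and> A $$ (i, j) = 1} \<le> 1" if "i < n" for i
    using that sv by (auto simp: card_le_Suc0_iff_eq ones_iff[symmetric] dest: single_valuedD)
  have "{i. i < n \<and> A $$ (i, j) = 1} = {i. i < n \<and> A $$ (j, i) = 1}" if "j < n" for j
    using s that by (intro Collect_cong) auto
  moreover have "transpose_mat A = A"
    by (rule eq_matI) (use c s in simp_all)
  ultimately show "A \<in> partial_involutions n"
    using c bin r by (simp add: partial_involutions_def)
qed

lemma rank_upper_left: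
  assumes "A \<in> partial_involutions n" "k \<le> n" "l \<le> n"
  shows "vec_space.rank k (upper_left A k l) = card (corner (ones A) k l)"
proof -
  have A: "A \<in> carrier_mat n n" "\<And>i j. i < n \<Longrightarrow> j < n \<Longrightarrow> A $$ (i, j) \<in> {0, 1}"
    "sym (ones A)" "single_valued (ones A)"
    using assms(1) by (auto simp: partial_involutions_iff)
  have "vec_space.rank k (upper_left A k l) =
      card {(i, j). i < k \<and> j < l \<and> upper_left A k l $$ (i, j) = 1}"
  proof (rule vec_space.rank_partial_permutation)
    show "upper_left A k l \<in> carrier_mat k l" by (simp add: upper_left_def)
    show "upper_left A k l $$ (i, j) \<in> {0, 1}" if "i < k" "j < l" for i j
      using A(2)[of i j] that assms(2,3) by (simp add: upper_left_def)
    show "j = j'" if "i < k" "j < l" "j' < l" "upper_left A k l $$ (i, j) = 1"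
      "upper_left A k l $$ (i, j') = 1" for i j j'
    proof -
      have "(i, j) \<in> ones A" "(i, j') \<in> ones A"
        using that assms(2,3) A(1) by (auto simp: upper_left_def ones_def)
      then show ?thesis using A(4) by (rule single_valuedD[rotated])
    qed
    show "i = i'" if "i < k" "i' < k" "j < l" "upper_left A k l $$ (i, j) = 1"
      "upper_left A k l $$ (i', j) = 1" for i i' j
    proof -
      have "(i, j) \<in> ones A" "(i', j) \<in> ones A"
        using that assms(2,3) A(1) by (auto simp: upper_left_def ones_def)
      \<comment> \<open>A shared column becomes a shared row after transposition, so
        \<open>single_valued\<close> applies.\<close>
      then have "(j, i) \<in> ones A" "(j, i') \<in> ones A" using A(3) by (auto dest: symD)
      then show ?thesis using A(4) by (rule single_valuedD[rotated])
    qed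
  qed
  also have "{(i, j). i < k \<and> j < l \<and> upper_left A k l $$ (i, j) = 1} = corner (ones A) k l"
    using assms(2,3) A(1) by (auto simp: upper_left_def corner_def ones_def)
  finally show ?thesis .
qed

text \<open>The range is extended to \<open>k = 0\<close> and \<open>l = 0\<close>, where corners
  are empty, because the differences in \<open>card_corner_Suc\<close> reach these indices.\<close>

lemma rank_le_iff_corner:
  assumes "A \<in> partial_involutions n" "B \<in> partial_involutions n"
  shows "rank_le n A B \<longleftrightarrow>
    (\<forall>k\<le>n. \<forall>l\<le>n. card (corner (ones A) k l) \<le> card (corner (ones B) k l))"
proof -
  have "rank_le n A B \<longleftrightarrow>
      (\<forall>k\<in>{1..n}. \<forall>l\<in>{1..n}. card (corner (ones A) k l) \<le> card (corner (ones B) k l))"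
    using assms by (simp add: rank_le_def rank_upper_left)
  also have "\<dots> \<longleftrightarrow>
      (\<forall>k\<le>n. \<forall>l\<le>n. card (corner (ones A) k l) \<le> card (corner (ones B) k l))" (is "?L \<longleftrightarrow> ?R")
  proof
    assume L: ?L
    show ?R
    proof (intro allI impI)
      fix k l assume "k \<le> n" "l \<le> n"
      then show "card (corner (ones A) k l) \<le> card (corner (ones B) k l)"
        using L by (cases "k = 0 \<or> l = 0") (auto simp: corner_def)
    qed
  qed simp
  finally show ?thesis .
qed

text \<open>Inclusion-exclusion: the mixed second difference of the corner counts is the entry at
  \<open>(i, j)\<close>. Sums on both sides avoid truncated subtraction.\<close>

lemma card_corner_Suc:
  assumes "finite X"
  shows "card (corner X (Suc i) (Suc j)) + card (corner X i j) =
    card (corner X (Suc i) j) + card (corner X i (Suc j)) + (if (i, j) \<in> X then 1 else 0)"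
proof -
  have fin: "finite (corner X k l)" for k l
    by (rule finite_subset[OF _ assms]) (auto simp: corner_def)
  have "corner X (Suc i) (Suc j) =
      (corner X (Suc i) j \<union> corner X i (Suc j)) \<union> (if (i, j) \<in> X then {(i, j)} else {})"
    and "corner X i j = corner X (Suc i) j \<inter> corner X i (Suc j)"
    and "(i, j) \<notin> corner X (Suc i) j \<union> corner X i (Suc j)"
    by (auto simp: corner_def less_Suc_eq split: if_splits)
  then show ?thesis
    using card_Un_Int[OF fin[of "Suc i" j] fin[of i "Suc j"]] fin[of "Suc i" j] fin[of i "Suc j"]
    by (cases "(i, j) \<in> X") simp_all
qed

text \<open>Each entry is a second difference of corner counts. This is the source of antisymmetry
  for \<open>rank_le\<close>.\<close>

lemma corner_cards_determine:
  assumes "X \<subseteq> {..<n} \<times> {..<n}" "Y \<subseteq> {..<n} \<times> {..<n}"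
    and eq: "\<And>k l. k \<le> n \<Longrightarrow> l \<le> n \<Longrightarrow> card (corner X k l) = card (corner Y k l)"
  shows "X = Y"
proof -
  have fin: "finite X" "finite Y" using assms(1,2) by (auto intro: finite_subset)
  have "(i, j) \<in> X \<longleftrightarrow> (i, j) \<in> Y" if "i < n" "j < n" for i j
  proof -
    have "card (corner X i j) = card (corner Y i j)"
      "card (corner X (Suc i) j) = card (corner Y (Suc i) j)"
      "card (corner X i (Suc j)) = card (corner Y i (Suc j))"
      "card (corner X (Suc i) (Suc j)) = card (corner Y (Suc i) (Suc j))"
      using that by (intro eq; simp)+
    then have "(if (i, j) \<in> X then 1 else 0 :: nat) = (if (i, j) \<in> Y then 1 else 0)"
      using card_corner_Suc[OF fin(1), of i j] card_corner_Suc[OF fin(2), of i j]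
      by linarith
    then show ?thesis by (simp split: if_splits)
  qed
  then show ?thesis using assms(1,2) by auto
qed

lemma partial_involutions_ones_eqD:
  assumes "A \<in> partial_involutions n" "B \<in> partial_involutions n" "ones A = ones B"
  shows "A = B"
proof (rule eq_matI)
  fix i j assume "i < dim_row B" "j < dim_col B"
  then have ij: "i < n" "j < n" using assms(2) by (auto simp: partial_involutions_iff)
  then have "A $$ (i, j) \<in> {0, 1}" "B $$ (i, j) \<in> {0, 1}"
    using assms(1,2) by (simp_all add: partial_involutions_iff)
  moreover have "(i, j) \<in> ones A \<longleftrightarrow> (i, j) \<in> ones B" by (simp add: assms(3))
  then have "A $$ (i, j) = 1 \<longleftrightarrow> B $$ (i, j) = 1"
    using ij assms(1,2) by (auto simp: ones_def partial_involutions_iff)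
  ultimately show "A $$ (i, j) = B $$ (i, j)" by auto
qed (use assms in \<open>auto simp: partial_involutions_iff\<close>)

lemma ones_subset: "A \<in> partial_involutions n \<Longrightarrow> ones A \<subseteq> {..<n} \<times> {..<n}"
  by (auto simp: partial_involutions_iff ones_def)

section \<open>Clans described by their sign positions and arcs\<close>

lift_definition plus_positions :: "clan \<Rightarrow> nat set" is "positions Plus"
  by (simp add: same_clan_def)

lift_definition minus_positions :: "clan \<Rightarrow> nat set" is "positions Minus"
  by (simp add: same_clan_def)

lift_definition clan_arcs :: "clan \<Rightarrow> (nat \<times> nat) set" is arcs
  by (simp add: same_clan_def)

text \<open>Equality in the quotient is \<open>same_clan\<close> on representatives, so these four
  invariants can replace words in the arguments that follow.\<close>

lemma clan_eq_iff:
  "\<gamma> = \<delta> \<longleftrightarrow> clan_length \<gamma> = clan_length \<delta> \<and> plus_positions \<gamma> = plus_positions \<delta> \<and>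
     minus_positions \<gamma> = minus_positions \<delta> \<and> clan_arcs \<gamma> = clan_arcs \<delta>"
  by transfer (auto simp: same_clan_def)

lemma clan_neg_rev:
  "clan_length (clan_neg (clan_rev \<gamma>)) = clan_length \<gamma>"
  "plus_positions (clan_neg (clan_rev \<gamma>)) = (\<lambda>s. clan_length \<gamma> - Suc s) ` minus_positions \<gamma>"
  "minus_positions (clan_neg (clan_rev \<gamma>)) = (\<lambda>s. clan_length \<gamma> - Suc s) ` plus_positions \<gamma>"
  "clan_arcs (clan_neg (clan_rev \<gamma>)) =
     (\<lambda>(s, t). (clan_length \<gamma> - Suc t, clan_length \<gamma> - Suc s)) ` clan_arcs \<gamma>"
  by (transfer, simp add: positions_negate positions_rev arcs_negate arcs_rev)+

lemma base_clan:
  "clan_length (base_clan \<gamma>) = clan_length \<gamma>"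
  "plus_positions (base_clan \<gamma>) = plus_positions \<gamma> \<union> snd ` clan_arcs \<gamma>"
  "minus_positions (base_clan \<gamma>) = minus_positions \<gamma> \<union> fst ` clan_arcs \<gamma>"
  "clan_arcs (base_clan \<gamma>) = {}"
  subgoal by transfer (simp add: base_word_def)
  by (transfer, simp add: same_clan_def positions_base_word arcs_base_word)+

lemma minus_plus_clan:
  "clan_length (minus_plus_clan n) = 2 * n"
  "plus_positions (minus_plus_clan n) = {n..<2 * n}"
  "minus_positions (minus_plus_clan n) = {..<n}"
  "clan_arcs (minus_plus_clan n) = {}"
  by (transfer, auto simp: positions_def arcs_def nth_append split: if_splits)+

text \<open>Both clan equations are read off component by component with the length
  \<open>2 * n\<close> substituted, which leaves set equations about signs and arcs.\<close>

lemma E_clans_iff: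
  "\<gamma> \<in> E_clans n \<longleftrightarrow> clan_length \<gamma> = 2 * n \<and>
     plus_positions \<gamma> = (\<lambda>s. 2 * n - Suc s) ` minus_positions \<gamma> \<and>
     minus_positions \<gamma> = (\<lambda>s. 2 * n - Suc s) ` plus_positions \<gamma> \<and>
     clan_arcs \<gamma> = (\<lambda>(s, t). (2 * n - Suc t, 2 * n - Suc s)) ` clan_arcs \<gamma> \<and>
     plus_positions \<gamma> \<union> snd ` clan_arcs \<gamma> = {n..<2 * n} \<and>
     minus_positions \<gamma> \<union> fst ` clan_arcs \<gamma> = {..<n}"
proof (cases "clan_length \<gamma> = 2 * n")
  case True
  show ?thesis
    unfolding E_clans_def skew_clans_def skew_symmetric_def mem_Collect_eq
      clan_eq_iff[of _ "minus_plus_clan n"] clan_eq_iff[of \<gamma>]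
      clan_neg_rev base_clan minus_plus_clan True
    by (rule iffI; elim conjE; intro conjI; (assumption | rule refl))
qed (simp add: E_clans_def skew_clans_def)

lemma clan_arcs_unique:
  assumes "(s, t) \<in> clan_arcs \<gamma>" "(s', t') \<in> clan_arcs \<gamma>" "s = s' \<or> t = t'"
  shows "s = s' \<and> t = t'"
  using assms by transfer (metis arc_unique same_clan_def)

lemma positions_disjoint:
  "plus_positions \<gamma> \<inter> snd ` clan_arcs \<gamma> = {}"
  "minus_positions \<gamma> \<inter> fst ` clan_arcs \<gamma> = {}"
  by (transfer, auto simp: positions_def arcs_def)+

lemma clan_plus_eq:
  "clan_plus \<gamma> i = card {s \<in> plus_positions \<gamma>. s < i} + card {(s, t) \<in> clan_arcs \<gamma>. t < i}"
  by transfer (simp add: count_list_eq_card_positions positions_take arcs_take)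

lemma clan_minus_eq:
  "clan_minus \<gamma> i = card {s \<in> minus_positions \<gamma>. s < i} + card {(s, t) \<in> clan_arcs \<gamma>. t < i}"
  by transfer (simp add: count_list_eq_card_positions positions_take arcs_take)

lemma clan_cross_eq: "clan_cross \<gamma> i j = card {(s, t) \<in> clan_arcs \<gamma>. s < i \<and> j \<le> t}"
  by transfer (simp add: Suc_le_eq less_Suc_eq_le)

section \<open>The matrix of a clan\<close>

text \<open>With positions counted from 0, the mirror image of \<open>j\<close> is
  \<open>2 * n - Suc j\<close>, so the columns \<open>j < n\<close> correspond to the right half of
  the word.\<close>

definition clan_matrix :: "nat \<Rightarrow> clan \<Rightarrow> real mat" where
  "clan_matrix n \<gamma> = mat n n (\<lambda>(i, j). if (i, 2 * n - Suc j) \<in> clan_arcs \<gamma> then 1 else 0)"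

text \<open>In the base clan left ends of arcs become minus and right ends plus, and these signs
  fill the two halves.\<close>

lemma E_clans_arcs_subset: "\<gamma> \<in> E_clans n \<Longrightarrow> clan_arcs \<gamma> \<subseteq> {..<n} \<times> {n..<2 * n}"
proof (rule subrelI)
  fix s t assume "\<gamma> \<in> E_clans n" "(s, t) \<in> clan_arcs \<gamma>"
  moreover from this have "s \<in> fst ` clan_arcs \<gamma>" "t \<in> snd ` clan_arcs \<gamma>"
    by (force intro: rev_image_eqI)+
  ultimately have "s \<in> {..<n}" "t \<in> {n..<2 * n}" unfolding E_clans_iff by blast+
  then show "(s, t) \<in> {..<n} \<times> {n..<2 * n}" by simp
qed

lemma finite_clan_arcs: "finite (clan_arcs \<gamma>)"
  by transfer (rule finite_arcs)

text \<open>The base clan prescribes the unions of signs and arc ends; since no end of an arc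
  carries a sign, the signs are the complements.\<close>

lemma E_clans_positions:
  assumes "\<gamma> \<in> E_clans n"
  shows "plus_positions \<gamma> = {n..<2 * n} - snd ` clan_arcs \<gamma>"
    and "minus_positions \<gamma> = {..<n} - fst ` clan_arcs \<gamma>"
  using assms positions_disjoint[of \<gamma>] unfolding E_clans_iff by blast+

lemma ones_clan_matrix:
  "ones (clan_matrix n \<gamma>) = {(i, j). i < n \<and> j < n \<and> (i, 2 * n - Suc j) \<in> clan_arcs \<gamma>}"
  by (auto simp: ones_def clan_matrix_def split: if_splits)

lemma clan_arcs_eq_ones:
  assumes "\<gamma> \<in> E_clans n"
  shows "clan_arcs \<gamma> = (\<lambda>(i, j). (i, 2 * n - Suc j)) ` ones (clan_matrix n \<gamma>)"
proof
  show "clan_arcs \<gamma> \<subseteq> (\<lambda>(i, j). (i, 2 * n - Suc j)) ` ones (clan_matrix n \<gamma>)"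
  proof (rule subrelI)
    fix s t assume st: "(s, t) \<in> clan_arcs \<gamma>"
    then have "s < n" "n \<le> t" "t < 2 * n" using E_clans_arcs_subset[OF assms] by auto
    then have "(s, 2 * n - Suc t) \<in> ones (clan_matrix n \<gamma>)" "t = 2 * n - Suc (2 * n - Suc t)"
      using st by (auto simp: ones_clan_matrix)
    then show "(s, t) \<in> (\<lambda>(i, j). (i, 2 * n - Suc j)) ` ones (clan_matrix n \<gamma>)"
      by force
  qed
qed (auto simp: ones_clan_matrix)

text \<open>Reversal takes the arc from \<open>i\<close> to the mirror of \<open>j\<close> to the
  arc from \<open>j\<close> to the mirror of \<open>i\<close>, which is transposition.
  Single-valuedness holds because a position lies on at most one arc.\<close>

lemma clan_matrix_partial_involution:
  assumes "\<gamma> \<in> E_clans n"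
  shows "clan_matrix n \<gamma> \<in> partial_involutions n"
  unfolding partial_involutions_iff
proof (intro conjI)
  show "sym (ones (clan_matrix n \<gamma>))"
  proof (rule symI)
    fix i j assume "(i, j) \<in> ones (clan_matrix n \<gamma>)"
    then have ij: "i < n" "j < n" "(i, 2 * n - Suc j) \<in> clan_arcs \<gamma>"
      by (auto simp: ones_clan_matrix)
    moreover have "clan_arcs \<gamma> = (\<lambda>(s, t). (2 * n - Suc t, 2 * n - Suc s)) ` clan_arcs \<gamma>"
      using assms by (simp add: E_clans_iff)
    ultimately have "(2 * n - Suc (2 * n - Suc j), 2 * n - Suc i) \<in> clan_arcs \<gamma>"
      by (metis (no_types, lifting) case_prod_conv image_eqI)
    then show "(j, i) \<in> ones (clan_matrix n \<gamma>)"
      using ij by (simp add: ones_clan_matrix)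
  qed
  show "single_valued (ones (clan_matrix n \<gamma>))"
  proof (rule single_valuedI)
    fix i j k assume "(i, j) \<in> ones (clan_matrix n \<gamma>)" "(i, k) \<in> ones (clan_matrix n \<gamma>)"
    then show "j = k"
      using clan_arcs_unique[of i "2 * n - Suc j" \<gamma> i "2 * n - Suc k"]
      by (auto simp: ones_clan_matrix)
  qed
qed (auto simp: clan_matrix_def)

text \<open>For a right end \<open>t = 2 * n - Suc j\<close>, the condition
  \<open>2 * n - l \<le> t\<close> says exactly \<open>j < l\<close>.\<close>

lemma card_corner_clan_matrix:
  assumes "\<gamma> \<in> E_clans n" "l \<le> n"
  shows "card (corner (ones (clan_matrix n \<gamma>)) k l) = clan_cross \<gamma> k (2 * n - l)"
proof -
  have "{(s, t) \<in> clan_arcs \<gamma>. s < k \<and> 2 * n - l \<le> t} =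
      (\<lambda>(i, j). (i, 2 * n - Suc j)) ` corner (ones (clan_matrix n \<gamma>)) k l"
    unfolding clan_arcs_eq_ones[OF assms(1)] corner_def
    using assms(2) by (force simp: ones_clan_matrix)
  moreover have "inj_on (\<lambda>(i, j). (i, 2 * n - Suc j)) (corner (ones (clan_matrix n \<gamma>)) k l)"
    by (auto simp: inj_on_def corner_def ones_clan_matrix)
  ultimately show ?thesis by (simp add: clan_cross_eq card_image)
qed

section \<open>The counting functions and the order on \<open>E_clans n\<close>\<close>

text \<open>Counting completed arcs by their right ends, the plus signs and arcs seen so far fill
  \<open>{n..<i}\<close> without overlap. The subtraction truncates to 0 for
  \<open>i \<le> n\<close>.\<close>

lemma clan_plus_E:
  assumes "\<gamma> \<in> E_clans n" "i \<le> 2 * n"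
  shows "clan_plus \<gamma> i = i - n"
proof -
  have inj: "inj_on snd (clan_arcs \<gamma>)"
    by (auto simp: inj_on_def dest: clan_arcs_unique)
  have "{s \<in> plus_positions \<gamma>. s < i} \<union> snd ` {(s, t) \<in> clan_arcs \<gamma>. t < i} = {n..<i}"
    "{s \<in> plus_positions \<gamma>. s < i} \<inter> snd ` {(s, t) \<in> clan_arcs \<gamma>. t < i} = {}"
    using assms(2) E_clans_arcs_subset[OF assms(1)]
    unfolding E_clans_positions[OF assms(1)] by force+
  moreover have "card (snd ` {(s, t) \<in> clan_arcs \<gamma>. t < i}) = card {(s, t) \<in> clan_arcs \<gamma>. t < i}"
    by (rule card_image, rule inj_on_subset[OF inj]) auto
  moreover have "finite (snd ` {(s, t) \<in> clan_arcs \<gamma>. t < i})"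
    by (rule finite_imageI, rule finite_subset[OF _ finite_clan_arcs]) auto
  moreover have "finite {s \<in> plus_positions \<gamma>. s < i}" by simp
  ultimately show ?thesis
    using card_Un_disjoint[of "{s \<in> plus_positions \<gamma>. s < i}"
        "snd ` {(s, t) \<in> clan_arcs \<gamma>. t < i}"]
    by (simp add: clan_plus_eq)
qed

text \<open>Each of the first \<open>min i n\<close> positions holds a minus sign, or starts an arc
  already closed before \<open>i\<close> (\<open>?A\<close>), or starts one still open
  (\<open>?B\<close>).\<close>

lemma clan_minus_E:
  assumes "\<gamma> \<in> E_clans n"
  shows "clan_minus \<gamma> i + clan_cross \<gamma> (min i n) (max i n) = min i n"
proof -
  let ?M = "{s \<in> minus_positions \<gamma>. s < i}"
  let ?A = "{(s, t) \<in> clan_arcs \<gamma>. t < i}"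
  let ?B = "{(s, t) \<in> clan_arcs \<gamma>. s < min i n \<and> max i n \<le> t}"
  have inj: "inj_on fst (clan_arcs \<gamma>)"
    by (auto simp: inj_on_def dest: clan_arcs_unique)
  have fin: "finite ?A" "finite ?B"
    by (rule finite_subset[OF _ finite_clan_arcs]; auto)+
  \<comment> \<open>Every arc has \<open>s < n \<le> t\<close>, so the bounds \<open>min i n\<close>
    and \<open>max i n\<close> in \<open>?B\<close> amount to \<open>s < i \<le> t\<close>.\<close>
  have "?A \<union> ?B = {(s, t) \<in> clan_arcs \<gamma>. s < i}" "?A \<inter> ?B = {}"
    using E_clans_arcs_subset[OF assms] by auto
  then have "card ?A + card ?B = card {(s, t) \<in> clan_arcs \<gamma>. s < i}"
    using card_Un_disjoint[OF fin] by simp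
  also have "\<dots> = card (fst ` {(s, t) \<in> clan_arcs \<gamma>. s < i})"
    by (rule card_image[symmetric], rule inj_on_subset[OF inj]) auto
  also have "card ?M + \<dots> = card (?M \<union> fst ` {(s, t) \<in> clan_arcs \<gamma>. s < i})"
  proof (rule card_Un_disjoint[symmetric])
    show "finite ?M" by simp
    show "finite (fst ` {(s, t) \<in> clan_arcs \<gamma>. s < i})"
      by (rule finite_imageI, rule finite_subset[OF _ finite_clan_arcs]) auto
    show "?M \<inter> fst ` {(s, t) \<in> clan_arcs \<gamma>. s < i} = {}"
      unfolding E_clans_positions[OF assms] by force
  qed
  also have "?M \<union> fst ` {(s, t) \<in> clan_arcs \<gamma>. s < i} = {..<min i n}"
    using E_clans_arcs_subset[OF assms] unfolding E_clans_positions[OF assms] by force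
  finally show ?thesis by (simp add: clan_minus_eq clan_cross_eq)
qed

lemma clan_cross_E:
  assumes "\<gamma> \<in> E_clans n"
  shows "clan_cross \<gamma> i j = clan_cross \<gamma> (min i n) (max j n)"
proof -
  have "{(s, t) \<in> clan_arcs \<gamma>. s < i \<and> j \<le> t} =
      {(s, t) \<in> clan_arcs \<gamma>. s < min i n \<and> max j n \<le> t}"
    using E_clans_arcs_subset[OF assms] by auto
  then show ?thesis by (simp add: clan_cross_eq)
qed

lemma clan_le_iff_cross:
  assumes \<gamma>: "\<gamma> \<in> E_clans n" and \<tau>: "\<tau> \<in> E_clans n"
  shows "clan_le n \<gamma> \<tau> \<longleftrightarrow>
    (\<forall>k\<le>n. \<forall>l\<le>n. clan_cross \<gamma> k (2 * n - l) \<le> clan_cross \<tau> k (2 * n - l))"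
    (is "_ \<longleftrightarrow> ?R")
proof
  assume le: "clan_le n \<gamma> \<tau>"
  show ?R
  proof (intro allI impI)
    fix k l assume kl: "k \<le> n" "l \<le> n"
    \<comment> \<open>For \<open>k \<le> n\<close> and \<open>l \<le> n\<close>, the inequality
      \<open>k < 2 * n - l\<close> fails only at \<open>k = l = n\<close>. For \<open>k = 0\<close>
      or \<open>l = 0\<close> no arc is counted.\<close>
    consider "k = 0" | "l = 0" | "k = n" "l = n" "n \<ge> 1" | "k \<ge> 1" "l \<ge> 1" "k < 2 * n - l"
      using kl by linarith
    then show "clan_cross \<gamma> k (2 * n - l) \<le> clan_cross \<tau> k (2 * n - l)"
    proof cases
      case 1
      then show ?thesis by (simp add: clan_cross_eq)
    next
      case 2
      then have "{(s, t) \<in> clan_arcs \<gamma>. s < k \<and> 2 * n - l \<le> t} = {}"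
        using E_clans_arcs_subset[OF \<gamma>] by auto
      then have "clan_cross \<gamma> k (2 * n - l) = 0"
        unfolding clan_cross_eq by (metis card.empty)
      then show ?thesis by simp
    next
      case 3
      \<comment> \<open>At \<open>i = n\<close> the minus count and the crossing number at
        \<open>(n, n)\<close> add up to \<open>n\<close>, so a larger minus count means a smaller
        crossing number.\<close>
      then have "clan_minus \<tau> n \<le> clan_minus \<gamma> n" using le by (auto simp: clan_le_def)
      then show ?thesis
        using clan_minus_E[OF \<gamma>, of n] clan_minus_E[OF \<tau>, of n] 3 by simp
    next
      case 4
      then show ?thesis using le by (auto simp: clan_le_def)
    qed
  qed
next
  assume R: ?R
  \<comment> \<open>This is the assumption with \<open>l = 2 * n - j\<close>; all conditions of
    \<open>clan_le\<close> reduce to this range through \<open>min\<close> and \<open>max\<close>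
    with \<open>n\<close>.\<close>
  have cross: "clan_cross \<gamma> k j \<le> clan_cross \<tau> k j" if "k \<le> n" "n \<le> j" "j \<le> 2 * n" for k j
    using R[rule_format, of k "2 * n - j"] that by simp
  show "clan_le n \<gamma> \<tau>"
    unfolding clan_le_def
  proof (intro conjI ballI)
    fix i assume "i \<in> {1..2 * n}"
    then have i: "i \<le> 2 * n" by simp
    show "clan_plus \<tau> i \<le> clan_plus \<gamma> i" using \<gamma> \<tau> i by (simp add: clan_plus_E)
    show "clan_minus \<tau> i \<le> clan_minus \<gamma> i"
      using clan_minus_E[OF \<gamma>, of i] clan_minus_E[OF \<tau>, of i] cross[of "min i n" "max i n"] i
      by simp
  next
    fix i j assume "i \<in> {1..2 * n}" "j \<in> {i<..2 * n}"
    then show "clan_cross \<gamma> i j \<le> clan_cross \<tau> i j"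
      using cross[of "min i n" "max j n"] clan_cross_E[OF \<gamma>, of i j] clan_cross_E[OF \<tau>, of i j]
      by simp
  qed
qed

lemma clan_le_iff_rank_le:
  assumes "\<gamma> \<in> E_clans n" "\<tau> \<in> E_clans n"
  shows "clan_le n \<gamma> \<tau> \<longleftrightarrow> rank_le n (clan_matrix n \<gamma>) (clan_matrix n \<tau>)"
  using assms
  by (simp add: clan_le_iff_cross rank_le_iff_corner clan_matrix_partial_involution
      card_corner_clan_matrix)

section \<open>Bijectivity of the passage from clans to matrices\<close>

lemma inj_on_clan_matrix: "inj_on (clan_matrix n) (E_clans n)"
proof (rule inj_onI)
  fix \<gamma> \<delta> assume "\<gamma> \<in> E_clans n" "\<delta> \<in> E_clans n" "clan_matrix n \<gamma> = clan_matrix n \<delta>"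
  moreover from this have "clan_arcs \<gamma> = clan_arcs \<delta>" using clan_arcs_eq_ones by metis
  ultimately show "\<gamma> = \<delta>"
    unfolding clan_eq_iff by (simp add: E_clans_positions) (simp add: E_clans_iff)
qed

text \<open>The word realizing a partial involution with graph \<open>X\<close>: position \<open>i < n\<close> and the mirror image
  of position \<open>j < n\<close> both carry the label \<open>i\<close> when \<open>(i, j) \<in> X\<close>.\<close>

definition involution_word :: "nat \<Rightarrow> (nat \<times> nat) set \<Rightarrow> clan_symbol list" where
  "involution_word n X = map (\<lambda>s.
     if s < n then if s \<in> Domain X then Label s else Minus
     else if 2 * n - Suc s \<in> Domain X
       then Label (THE i. (i, 2 * n - Suc s) \<in> X) else Plus) [0..<2 * n]"

text \<open>Surjectivity. A fixed point \<open>(i, i)\<close> yields one arc from \<open>i\<close>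
  to its own mirror image, and a swapped pair yields two arcs with different labels, exchanged by
  reflection.\<close>

lemma exists_clan_with_arcs:
  assumes sub: "X \<subseteq> {..<n} \<times> {..<n}" and sym: "sym X" and sv: "single_valued X"
  obtains \<gamma> where "\<gamma> \<in> E_clans n" "clan_arcs \<gamma> = (\<lambda>(i, j). (i, 2 * n - Suc j)) ` X"
proof -
  let ?w = "involution_word n X"
  let ?m = "\<lambda>s. 2 * n - Suc s"
  have len: "length ?w = 2 * n" by (simp add: involution_word_def)
  \<comment> \<open>The description fixes the second component, so uniqueness combines
    \<open>single_valued X\<close> with symmetry.\<close>
  have the: "(THE i. (i, j) \<in> X) = i" if "(i, j) \<in> X" for i j
    using that sym sv by (auto intro!: the_equality dest: symD single_valuedD)
  have dom: "i \<in> Domain X \<longleftrightarrow> (\<exists>j. (j, i) \<in> X)" for i using sym by (auto dest: symD)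
  have low: "?w ! s = (if s \<in> Domain X then Label s else Minus)" if "s < n" for s
    using that by (simp add: involution_word_def)
  have high: "?w ! s = (if ?m s \<in> Domain X then Label (THE i. (i, ?m s) \<in> X) else Plus)"
    if "n \<le> s" "s < 2 * n" for s
    using that by (simp add: involution_word_def)
  have high_label: "?w ! s = Label a \<longleftrightarrow> (a, ?m s) \<in> X" if "n \<le> s" "s < 2 * n" for s a
    using high[OF that] the dom[of "?m s"] by (auto dest: the)
  have labels: "positions (Label a) ?w = (\<Union>j\<in>X `` {a}. {a, ?m j})" for a
  proof (rule Set.set_eqI)
    fix s
    consider "s < n" | "n \<le> s" "s < 2 * n" | "2 * n \<le> s" by linarith
    then show "s \<in> positions (Label a) ?w \<longleftrightarrow> s \<in> (\<Union>j\<in>X `` {a}. {a, ?m j})"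
    proof cases
      case 1
      then show ?thesis using low[OF 1] sub by (auto simp: positions_def len)
    next
      case 2
      have "(a, ?m s) \<in> X \<longleftrightarrow> (\<exists>j. (a, j) \<in> X \<and> (s = a \<or> s = ?m j))"
        using 2 sub by fastforce
      then show ?thesis using 2 high_label[OF 2, of a] by (auto simp: positions_def len)
    next
      case 3
      then show ?thesis using sub by (auto simp: positions_def len)
    qed
  qed
  have arcs: "arcs ?w = (\<lambda>(i, j). (i, ?m j)) ` X"
  proof (rule Set.set_eqI, simp only: split_paired_all)
    fix s t
    have "(s, t) \<in> arcs ?w \<longleftrightarrow>
        s < t \<and> (\<exists>a. s \<in> positions (Label a) ?w \<and> t \<in> positions (Label a) ?w)"
      by (auto simp: arcs_def positions_def)
    \<comment> \<open>Single-valuedness makes both memberships refer to the same \<open>j\<close>,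
      and \<open>a < n \<le> ?m j\<close> identifies \<open>a\<close> as the left end.\<close>
    also have "\<dots> \<longleftrightarrow> (s, t) \<in> (\<lambda>(i, j). (i, ?m j)) ` X"
      unfolding labels using sub sv by (fastforce dest: single_valuedD)
    finally show "(s, t) \<in> arcs ?w \<longleftrightarrow> (s, t) \<in> (\<lambda>(i, j). (i, ?m j)) ` X" .
  qed
  have minus: "positions Minus ?w = {..<n} - Domain X"
  proof (rule Set.set_eqI)
    fix s show "s \<in> positions Minus ?w \<longleftrightarrow> s \<in> {..<n} - Domain X"
      using low[of s] high[of s] by (cases "s < n") (auto simp: positions_def len)
  qed
  have plus: "positions Plus ?w = ?m ` ({..<n} - Domain X)"
  proof (rule Set.set_eqI)
    fix s
    have "s \<in> positions Plus ?w \<longleftrightarrow> n \<le> s \<and> s < 2 * n \<and> ?m s \<notin> Domain X"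
      using low[of s] high[of s] by (cases "s < n") (auto simp: positions_def len split: if_splits)
    also have "\<dots> \<longleftrightarrow> s \<in> ?m ` ({..<n} - Domain X)"
    proof
      assume "n \<le> s \<and> s < 2 * n \<and> ?m s \<notin> Domain X"
      then have "?m s \<in> {..<n} - Domain X" "s = ?m (?m s)" by auto
      then show "s \<in> ?m ` ({..<n} - Domain X)" by blast
    qed auto
    finally show "s \<in> positions Plus ?w \<longleftrightarrow> s \<in> ?m ` ({..<n} - Domain X)" .
  qed
  have "clan_word ?w"
    unfolding clan_word_def count_list_eq_card_positions
  proof (intro conjI allI impI)
    fix a assume "Label a \<in> set ?w"
    then have "positions (Label a) ?w \<noteq> {}" by (auto simp: positions_def in_set_conv_nth)
    then obtain j where j: "(a, j) \<in> X" unfolding labels by blast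
    then have "X `` {a} = {j}" using sv by (auto dest: single_valuedD)
    then have "positions (Label a) ?w = {a, ?m j}" by (simp add: labels)
    moreover have "a < n" "j < n" using j sub by auto
    then have "a \<noteq> ?m j" by linarith
    ultimately show "card (positions (Label a) ?w) = 2" by simp
  next
    have "inj_on ?m ({..<n} - Domain X)" by (auto simp: inj_on_def)
    then show "card (positions Plus ?w) = card (positions Minus ?w)"
      by (simp add: plus minus card_image)
  qed
  then have w: "same_clan ?w ?w" by (simp add: same_clan_def)
  define \<gamma> where "\<gamma> = abs_clan ?w"
  have \<gamma>: "clan_length \<gamma> = 2 * n" "plus_positions \<gamma> = ?m ` ({..<n} - Domain X)"
    "minus_positions \<gamma> = {..<n} - Domain X" "clan_arcs \<gamma> = (\<lambda>(i, j). (i, ?m j)) ` X"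
    using w len plus minus arcs
    by (simp_all add: \<gamma>_def clan_length.abs_eq plus_positions.abs_eq minus_positions.abs_eq
        clan_arcs.abs_eq)
  \<comment> \<open>Subtraction on \<open>nat\<close> truncates; the bound on \<open>S\<close> makes
    double reflection the identity there.\<close>
  have mirror: "?m ` ?m ` S = S" if "S \<subseteq> {..<2 * n}" for S
    using that by (force simp: image_image)
  have "\<gamma> \<in> E_clans n"
    unfolding E_clans_iff \<gamma>
  proof (intro conjI)
    show "{..<n} - Domain X = ?m ` ?m ` ({..<n} - Domain X)" by (rule mirror[symmetric]) auto
    show "(\<lambda>(i, j). (i, ?m j)) ` X = (\<lambda>(s, t). (?m t, ?m s)) ` (\<lambda>(i, j). (i, ?m j)) ` X"
    proof -
      \<comment> \<open>Reflecting the arc \<open>(i, ?m j)\<close> gives \<open>(j, ?m i)\<close>,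
        so reflection acts on \<open>X\<close> as the converse.\<close>
      have "(\<lambda>(s, t). (?m t, ?m s)) ` (\<lambda>(i, j). (i, ?m j)) ` X = (\<lambda>(i, j). (j, ?m i)) ` X"
        unfolding image_image using sub by (intro image_cong) auto
      also have "\<dots> = (\<lambda>(i, j). (i, ?m j)) ` (X\<inverse>)"
        by (auto simp: image_iff Bex_def)
      also have "X\<inverse> = X" using sym by (simp add: sym_conv_converse_eq)
      finally show ?thesis ..
    qed
    have "snd ` (\<lambda>(i, j). (i, ?m j)) ` X = ?m ` Range X"
      by (auto simp: image_image Range_snd case_prod_unfold)
    also have "Range X = Domain X" using dom by blast
    finally have "snd ` (\<lambda>(i, j). (i, ?m j)) ` X = ?m ` Domain X" .
    then have "?m ` ({..<n} - Domain X) \<union> snd ` (\<lambda>(i, j). (i, ?m j)) ` X =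
        ?m ` ({..<n} - Domain X \<union> Domain X)" by blast
    also have "{..<n} - Domain X \<union> Domain X = {..<n}" using sub by auto
    also have "?m ` {..<n} = {n..<2 * n}"
    proof
      show "{n..<2 * n} \<subseteq> ?m ` {..<n}"
      proof
        fix t assume "t \<in> {n..<2 * n}"
        then have "t = ?m (?m t)" "?m t \<in> {..<n}" by auto
        then show "t \<in> ?m ` {..<n}" by blast
      qed
    qed auto
    finally show "?m ` ({..<n} - Domain X) \<union> snd ` (\<lambda>(i, j). (i, ?m j)) ` X = {n..<2 * n}" .
    have "fst ` (\<lambda>(i, j). (i, ?m j)) ` X = Domain X"
      by (simp add: image_image Domain_fst case_prod_unfold)
    then show "{..<n} - Domain X \<union> fst ` (\<lambda>(i, j). (i, ?m j)) ` X = {..<n}"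
      using sub by auto
  qed simp_all
  then show thesis using \<gamma>(4) by (rule that)
qed

lemma bij_betw_clan_matrix: "bij_betw (clan_matrix n) (E_clans n) (partial_involutions n)"
  unfolding bij_betw_def
proof (intro conjI equalityI subsetI)
  show "inj_on (clan_matrix n) (E_clans n)" by (rule inj_on_clan_matrix)
  show "A \<in> partial_involutions n" if "A \<in> clan_matrix n ` E_clans n" for A
    using that clan_matrix_partial_involution by blast
  show "A \<in> clan_matrix n ` E_clans n" if A: "A \<in> partial_involutions n" for A
  proof -
    have sub: "ones A \<subseteq> {..<n} \<times> {..<n}" using A by (rule ones_subset)
    obtain \<gamma> where \<gamma>: "\<gamma> \<in> E_clans n" "clan_arcs \<gamma> = (\<lambda>(i, j). (i, 2 * n - Suc j)) ` ones A"
      using exists_clan_with_arcs[OF sub] A by (auto simp: partial_involutions_iff)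
    have "ones (clan_matrix n \<gamma>) = ones A"
    proof (rule Set.set_eqI, simp only: split_paired_all)
      fix i j
      \<comment> \<open>The arcs are given as an image, so membership only provides some
        \<open>j'\<close> with the same mirror image; below \<open>n\<close> reflection is
        injective.\<close>
      have "(i, j) \<in> ones A" if "i < n" "j < n" "(i, j') \<in> ones A"
        "2 * n - Suc j = 2 * n - Suc j'" for j'
      proof -
        have "j' < n" using that(3) sub by auto
        then have "j' = j" using that(2,4) by linarith
        then show ?thesis using that(3) by simp
      qed
      then show "(i, j) \<in> ones (clan_matrix n \<gamma>) \<longleftrightarrow> (i, j) \<in> ones A"
        using sub by (auto simp: ones_clan_matrix \<gamma>(2))
    qed
    then have "clan_matrix n \<gamma> = A"
      using clan_matrix_partial_involution[OF \<gamma>(1)] A by (intro partial_involutions_ones_eqD)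
    then show ?thesis using \<gamma>(1) by blast
  qed
qed

section \<open>Partial order axioms and the isomorphism\<close>

lemma rank_le_antisym:
  assumes "A \<in> partial_involutions n" "B \<in> partial_involutions n" "rank_le n A B" "rank_le n B A"
  shows "A = B"
proof (rule partial_involutions_ones_eqD[OF assms(1,2)])
  show "ones A = ones B"
  proof (rule corner_cards_determine)
    show "card (corner (ones A) k l) = card (corner (ones B) k l)" if "k \<le> n" "l \<le> n" for k l
      using assms that by (simp add: rank_le_iff_corner le_antisym)
  qed (use assms(1,2) ones_subset in blast)+
qed

lemma partial_order_on_rank_le:
  "partial_order_on (partial_involutions n) (relation_of (rank_le n) (partial_involutions n))"
proof (rule partial_order_on_relation_ofI)
  show "rank_le n A A" for A by (simp add: rank_le_def)
  show "rank_le n A C" if "rank_le n A B" "rank_le n B C" for A B C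
    using that unfolding rank_le_def by (meson order_trans)
qed (rule rank_le_antisym)

text \<open>Antisymmetry is pulled back from \<open>rank_le\<close> along the injective map
  \<open>clan_matrix n\<close>.\<close>

lemma partial_order_on_clan_le:
  "partial_order_on (E_clans n) (relation_of (clan_le n) (E_clans n))"
proof (rule partial_order_on_relation_ofI)
  show "clan_le n \<gamma> \<gamma>" for \<gamma> by (simp add: clan_le_def)
  show "clan_le n \<gamma> \<epsilon>" if "clan_le n \<gamma> \<delta>" "clan_le n \<delta> \<epsilon>" for \<gamma> \<delta> \<epsilon>
    using that unfolding clan_le_def by (meson order_trans)
  show "\<gamma> = \<delta>" if "\<gamma> \<in> E_clans n" "\<delta> \<in> E_clans n" "clan_le n \<gamma> \<delta>" "clan_le n \<delta> \<gamma>" for \<gamma> \<delta>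
    using that inj_on_clan_matrix[of n]
    by (metis clan_le_iff_rank_le clan_matrix_partial_involution inj_onD rank_le_antisym)
qed

theorem theorem6p9:
  fixes n :: nat
  assumes "n \<ge> 1"
  shows "poset_isomorphic (E_clans n) (clan_le n) (partial_involutions n) (rank_le n)"
  unfolding poset_isomorphic_def
  using partial_order_on_clan_le partial_order_on_rank_le bij_betw_clan_matrix clan_le_iff_rank_le
  by blast

end
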